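(* Let $s$ be a positive integer and let $m_1,\dots,m_s$ be positive integers with $\gcd(m_1,m_2,\dots,m_s)=1$. For each positive integer $n$ let $$a_n=\frac{((m_1+m_2+\dots+m_s)n)!}{(m_1n)!\,(m_2n)!\cdots(m_sn)!}.$$ Then for every positive integer $k$ the sequence $(a_n)_{n\ge 1}$ is almost mean $k$-divisible, i.e. there exists a positive integer $C=C(k)$ such that $$\frac{\prod_{n=1}^t a_{kn}}{\prod_{n=1}^t a_n}\in\frac1C\mathbb{Z}$$ for every positive integer $t$.
   Context: A sequence $(a_n)_{n\ge1}$ of nonzero integers is called almost mean $k$-divisible (for a positive integer $k$) if there is a positive integer $C=C(k)$ such that $\left(\prod_{n=1}^t a_{kn}\right)/\left(\prod_{n=1}^t a_n\right)\in\frac1C\mathbb{Z}$ for every positive integer $t$. *)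

theory Defs
  imports Complex_Main
begin

(* The sequence is indexed from 1; the value a 0 is never used when k > 0.  Sequences of
   nonzero integers are represented as rational sequences whose values are nonzero
   integers, so that sequences given by quotients need no truncating division. *)
definition almost_mean_divisible :: "nat \<Rightarrow> (nat \<Rightarrow> rat) \<Rightarrow> bool" where
  "almost_mean_divisible k a \<longleftrightarrow>
     (\<forall>n\<ge>1. a n \<in> \<int> \<and> a n \<noteq> 0) \<and>
     (\<exists>C::nat. C > 0 \<and>
        (\<forall>t\<ge>1. \<exists>z::int. (\<Prod>n=1..t. a (k * n)) / (\<Prod>n=1..t. a n) = of_int z / of_nat C))"

end

theory Submission
  imports Defs "HOL-Analysis.Analysis" "HOL-Number_Theory.Cong"
begin

text \<open>
  Put \<open>M = \<Sum>i. m\<^sub>i\<close> and \<open>f x = \<lfloor>M x\<rfloor> - (\<Sum>i. \<lfloor>m\<^sub>i x\<rfloor>)\<close>. By Legendre's formula the \<open>p\<close>-adic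
  valuation of \<open>a\<^sub>n\<close> is the sum of \<open>f (n / p\<^sup>j)\<close> over \<open>j \<ge> 1\<close>. Since \<open>a\<^bsub>p n\<^esub>\<close> and \<open>a\<^sub>n\<close> have the
  same \<open>p\<close>-adic valuation, \<open>k\<close> may be replaced by its part \<open>b\<close> prime to \<open>p\<close>. For \<open>q = p\<^sup>j\<close> the
  excess \<open>\<Sum>n\<le>t. f (b n / q) - f (n / q)\<close> is then periodic in \<open>t\<close> with period \<open>q\<close>, hence bounded
  for each \<open>q\<close>, and it suffices to show that it is nonnegative for all large \<open>q\<close>.

  Let \<open>0 \<le> t < q\<close>. If \<open>t / q\<close> is within \<open>1 / M\<close> of \<open>0\<close> or \<open>1\<close>, this holds because \<open>f\<close> attains its
  minimum near \<open>0\<close> and its maximum near \<open>1\<close>. Otherwise the excess is \<open>(q / b) G (t / q) + O(1)\<close>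
  with \<open>G x = (\<Sum>i. \<psi> (m\<^sub>i x) / m\<^sub>i) - \<psi> (M x) / M\<close> and \<open>\<psi> y = b \<Phi> y - \<Phi> (b y)\<close>, where \<open>\<Phi>\<close> is the
  integral of the floor function. Up to the term \<open>b (b - 1) y\<^sup>2 / 2\<close>, which cancels in \<open>G\<close>, \<open>\<psi>\<close> is
  the minimum over integer vectors \<open>c\<close> with \<open>b - 1\<close> entries of a fixed positive definite quadratic
  form at \<open>(y, \<dots>, y) - c\<close>. So \<open>G \<ge> 0\<close> by the Cauchy--Schwarz inequality, and \<open>gcd (m\<^sub>1, \<dots>, m\<^sub>s) = 1\<close>
  makes \<open>G\<close> strictly positive on the interval \<open>[1 / M, 1 - 1 / M]\<close>, hence bounded below there.
\<close>

section \<open>The integral of the floor function\<close>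

text \<open>The integral of the floor function from \<open>0\<close> to \<open>y\<close>.\<close>

definition floor_int :: "real \<Rightarrow> real" where
  "floor_int y = y * of_int \<lfloor>y\<rfloor> - of_int \<lfloor>y\<rfloor> * (of_int \<lfloor>y\<rfloor> + 1) / 2"

lemma floor_int_0 [simp]: "floor_int 0 = 0"
  by (simp add: floor_int_def)

text \<open>The line subtracted is the affine piece of \<open>floor_int\<close> on [N, N + 1],
  extended to all y. The factored difference exposes its sign and its zeros.\<close>

lemma floor_int_gap:
  "floor_int y - (N * y - N * (N + 1) / 2) =
     real_of_int (\<lfloor>y\<rfloor> - N) * (real_of_int (\<lfloor>y\<rfloor> - N) - 1 + 2 * frac y) / 2"
  by (simp add: floor_int_def frac_def field_simps)

text \<open>In \<open>floor_int_gap\<close> both factors are nonnegative if d >= 1 and nonpositive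
  if d <= -1. Hence each affine piece is a supporting line.\<close>

lemma floor_int_ge: "of_int N * y - of_int N * (of_int N + 1) / 2 \<le> floor_int y"
proof -
  define d where "d = \<lfloor>y\<rfloor> - N"
  have fr: "0 \<le> frac y" "frac y < 1" by (simp_all add: frac_lt_1)
  have "real_of_int d * (real_of_int d - 1 + 2 * frac y) \<ge> 0"
  proof (cases "d \<ge> 1")
    case True
    then have "real_of_int d \<ge> 1" by linarith
    with fr show ?thesis by (intro mult_nonneg_nonneg) linarith+
  next
    case False
    show ?thesis
    proof (cases "d = 0")
      case False
      with \<open>\<not> d \<ge> 1\<close> have "real_of_int d \<le> -1" by linarith
      with fr show ?thesis by (intro mult_nonpos_nonpos) linarith+
    qed simp
  qed
  then show ?thesis using floor_int_gap[of y N] by (simp add: d_def)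
qed

lemma floor_int_eqD:
  assumes "floor_int y = of_int N * y - of_int N * (of_int N + 1) / 2"
  shows "of_int N \<le> y \<and> y \<le> of_int N + 1"
proof -
  define d where "d = \<lfloor>y\<rfloor> - N"
  have fr: "0 \<le> frac y" "frac y < 1" by (simp_all add: frac_lt_1)
  have y: "y = of_int N + of_int d + frac y" by (simp add: d_def frac_def)
  have "real_of_int d * (real_of_int d - 1 + 2 * frac y) = 0"
    using floor_int_gap[of y N] assms by (simp add: d_def)
  then have "d = 0 \<or> real_of_int d = 1 - 2 * frac y"
    by (simp only: mult_eq_0_iff of_int_eq_0_iff) linarith
  then consider "d = 0" | "real_of_int d = 1 - 2 * frac y" by blast
  then show ?thesis
  proof cases
    case 1
    with y have "y = of_int N + frac y" by simp
    with fr show ?thesis by linarith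
  next
    \<comment> \<open>Here d = 0 means y = N + 1/2, and d = 1 means y = N + 1.\<close>
    case 2
    with fr have "real_of_int d > -1" "real_of_int d \<le> 1" by linarith+
    then have "d = 0 \<or> d = 1" by linarith
    then have "real_of_int d = 0 \<or> real_of_int d = 1" by auto
    with 2 y fr show ?thesis by (elim disjE; intro conjI; linarith)
  qed
qed

lemma floor_int_step_le: "floor_int y - floor_int (y - h) \<le> h * of_int \<lfloor>y\<rfloor>"
  using floor_int_ge[of "\<lfloor>y\<rfloor>" "y - h"] by (simp add: floor_int_def algebra_simps)

lemma floor_int_step_ge: "h * of_int \<lfloor>y\<rfloor> \<le> floor_int (y + h) - floor_int y"
  using floor_int_ge[of "\<lfloor>y\<rfloor>" "y + h"] by (simp add: floor_int_def algebra_simps)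

text \<open>The affine piece at the intermediate point lies below \<open>floor_int\<close> at both
  endpoints. Convexity then gives continuity without gluing pieces.\<close>

lemma convex_on_floor_int: "convex_on UNIV floor_int"
proof (rule convex_onI)
  fix t x y :: real
  assume t: "0 < t" "t < 1"
  let ?z = "(1 - t) *\<^sub>R x + t *\<^sub>R y"
  define N where "N = \<lfloor>?z\<rfloor>"
  have "floor_int ?z = ?z * of_int N - of_int N * (of_int N + 1) / 2"
    by (simp only: floor_int_def N_def)
  also have "\<dots> = (1 - t) * (of_int N * x - of_int N * (of_int N + 1) / 2)
      + t * (of_int N * y - of_int N * (of_int N + 1) / 2)"
    by (simp add: field_simps)
  also have "\<dots> \<le> (1 - t) * floor_int x + t * floor_int y"
    using t by (intro add_mono mult_left_mono[OF floor_int_ge]) auto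
  finally show "floor_int ?z \<le> (1 - t) * floor_int x + t * floor_int y" .
qed simp

lemma continuous_floor_int: "continuous_on UNIV floor_int"
  by (rule convex_on_continuous[OF open_UNIV convex_on_floor_int])

text \<open>A right-endpoint Riemann sum of a nondecreasing function is at least the
  integral.\<close>

lemma sum_floor_ge:
  assumes "h \<ge> 0"
  shows "floor_int (real t * h) \<le> h * (\<Sum>n=1..t. of_int \<lfloor>real n * h\<rfloor>)"
proof (induction t)
  case (Suc t)
  have "floor_int (real (Suc t) * h) - floor_int (real t * h) \<le> h * \<lfloor>real (Suc t) * h\<rfloor>"
    using floor_int_step_le[of "real (Suc t) * h" h] by (simp add: algebra_simps)
  with Suc show ?case by (simp add: algebra_simps)
qed simp

text \<open>Dropping the last term leaves a left-endpoint Riemann sum, which is at most the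
  integral.\<close>

lemma sum_floor_le:
  assumes "h \<ge> 0"
  shows "h * (\<Sum>n=1..t. of_int \<lfloor>real n * h\<rfloor>) \<le> floor_int (real t * h) + h * \<lfloor>real t * h\<rfloor>"
proof (induction t)
  case (Suc t)
  have "h * \<lfloor>real t * h\<rfloor> \<le> floor_int (real (Suc t) * h) - floor_int (real t * h)"
    using floor_int_step_ge[of h "real t * h"] by (simp add: algebra_simps)
  with Suc show ?case by (simp add: algebra_simps)
qed simp

section \<open>The defect \<psi> as a minimum of a quadratic form\<close>

definition dilation_defect :: "nat \<Rightarrow> real \<Rightarrow> real" where
  "dilation_defect k y = real k * floor_int y - floor_int (real k * y)"

text \<open>
  Consecutive integers have a nonnegative product, and the last summand is nonnegative by
  \<open>floor_int_ge\<close>. So the left-hand side is an upper bound for the defect, for every \<open>c\<close>.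
\<close>

lemma dilation_defect_eq:
  fixes c :: "nat \<Rightarrow> int" and y :: real
  assumes "k \<ge> 1"
  defines "n \<equiv> \<Sum>r\<in>{1..<k}. c r" and "l \<equiv> \<lfloor>y\<rfloor>"
  shows "(of_int (n\<^sup>2) + (\<Sum>r\<in>{1..<k}. of_int ((c r)\<^sup>2))) / 2 - n * real k * y =
    dilation_defect k y + (\<Sum>r\<in>{1..<k}. of_int ((c r - l) * (c r - l - 1))) / 2
     + (floor_int (real k * y)
         - (of_int (n + l) * (real k * y) - of_int (n + l) * (of_int (n + l) + 1) / 2))"
proof -
  have "(\<Sum>r\<in>{1..<k}. (c r - l) * (c r - l - 1))
      = (\<Sum>r\<in>{1..<k}. (c r)\<^sup>2 - (2 * l + 1) * c r + (l\<^sup>2 + l))"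
    by (intro sum.cong) (auto simp: algebra_simps power2_eq_square)
  also have "\<dots> = (\<Sum>r\<in>{1..<k}. (c r)\<^sup>2) - (2 * l + 1) * n + (int k - 1) * (l\<^sup>2 + l)"
    using assms(1) by (simp add: sum.distrib sum_subtractf n_def sum_distrib_left of_nat_diff)
  finally have "(\<Sum>r\<in>{1..<k}. real_of_int ((c r - l) * (c r - l - 1)))
     = (\<Sum>r\<in>{1..<k}. of_int ((c r)\<^sup>2)) - (2 * l + 1) * n + (real k - 1) * (l\<^sup>2 + l)"
    by (simp only: of_int_sum [symmetric]) simp
  then show ?thesis
    unfolding dilation_defect_def floor_int_def[of y] l_def[symmetric]
    by (simp add: field_simps power2_eq_square)
qed

lemma dilation_defect_attained:
  fixes y :: real
  assumes "k \<ge> 1"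
  obtains c :: "nat \<Rightarrow> int" where
    "dilation_defect k y = (of_int ((\<Sum>r\<in>{1..<k}. c r)\<^sup>2) + (\<Sum>r\<in>{1..<k}. of_int ((c r)\<^sup>2))) / 2
       - of_int (\<Sum>r\<in>{1..<k}. c r) * real k * y"
proof -
  define l where "l = \<lfloor>y\<rfloor>"
  define N where "N = \<lfloor>real k * y\<rfloor>"
  define e where "e = nat (N - int k * l)"
  have "real k * l \<le> real k * y" by (simp add: l_def mult_left_mono)
  then have N1: "int k * l \<le> N" unfolding N_def by (simp add: le_floor_iff)
  have "real k * y < real k * (l + 1)" using assms by (simp add: l_def)
  then have "N < int k * (l + 1)" unfolding N_def by (simp add: floor_less_iff)
  then have e: "e < k" "int e = N - int k * l" using N1 by (auto simp: e_def algebra_simps)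
  \<comment> \<open>There are k - 1 entries and e < k, so exactly e of them are raised to l + 1.
    Entries l or l + 1 kill the products of consecutive integers; the total N - l makes the
    supporting line exact at k y.\<close>
  define c where "c r = l + (if r \<le> e then 1 else 0)" for r :: nat
  have "{1..<k} \<inter> {r. r \<le> e} = {1..e}" using e by auto
  then have "(\<Sum>r\<in>{1..<k}. (if r \<le> e then 1 else 0::int)) = int e"
    by (simp add: sum.If_cases)
  then have "(\<Sum>r\<in>{1..<k}. c r) = (int k - 1) * l + int e"
    using assms by (simp add: c_def sum.distrib of_nat_diff)
  then have n: "(\<Sum>r\<in>{1..<k}. c r) + l = N" using e by (simp add: algebra_simps)
  have z: "(\<Sum>r\<in>{1..<k}. real_of_int ((c r - l) * (c r - l - 1))) = 0"
    by (intro sum.neutral) (auto simp: c_def)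
  have gap: "floor_int (real k * y) - (of_int ((\<Sum>r\<in>{1..<k}. c r) + l) * (real k * y)
      - of_int ((\<Sum>r\<in>{1..<k}. c r) + l) * (of_int ((\<Sum>r\<in>{1..<k}. c r) + l) + 1) / 2) = 0"
    unfolding n floor_int_def N_def[symmetric] by simp
  show ?thesis
    by (rule that[of c])
      (use dilation_defect_eq[OF assms, of c y, folded l_def, unfolded z gap] in linarith)
qed

text \<open>Cauchy--Schwarz with its remainder, a weighted variance of the ratios
  \<open>c i / w i\<close>. The exact form is needed because a zero remainder forces
  proportionality.\<close>

lemma sum_square_div_eq:
  fixes c w :: "'a \<Rightarrow> real"
  assumes "finite I" "\<And>i. i \<in> I \<Longrightarrow> w i > 0" "I \<noteq> {}"
  shows "(\<Sum>i\<in>I. (c i)\<^sup>2 / w i) - (sum c I)\<^sup>2 / sum w I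
      = (\<Sum>i\<in>I. w i * (c i / w i - sum c I / sum w I)\<^sup>2)"
proof -
  define L where "L = sum c I / sum w I"
  have "sum w I > 0" using assms by (simp add: sum_pos)
  then have L: "sum c I = L * sum w I" by (simp add: L_def)
  have "(\<Sum>i\<in>I. w i * (c i / w i - L)\<^sup>2) = (\<Sum>i\<in>I. (c i)\<^sup>2 / w i - 2 * L * c i + L\<^sup>2 * w i)"
    by (intro sum.cong) (use assms in \<open>force simp: field_simps power2_eq_square\<close>)+
  also have "\<dots> = (\<Sum>i\<in>I. (c i)\<^sup>2 / w i) - 2 * L * sum c I + L\<^sup>2 * sum w I"
    by (simp add: sum.distrib sum_subtractf sum_distrib_left)
  also have "\<dots> = (\<Sum>i\<in>I. (c i)\<^sup>2 / w i) - (sum c I)\<^sup>2 / sum w I"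
    using \<open>sum w I > 0\<close> unfolding L by (simp add: field_simps power2_eq_square)
  finally show ?thesis by (simp add: L_def)
qed

section \<open>Positivity of the gain\<close>

locale coprime_parts =
  fixes I :: "'a set" and m :: "'a \<Rightarrow> nat"
  assumes fin: "finite I" and pos: "\<And>i. i \<in> I \<Longrightarrow> m i > 0"
    and Gcd_eq_1: "Gcd (m ` I) = 1"
begin

definition M :: nat where "M = sum m I"

lemma nonempty: "I \<noteq> {}"
  using Gcd_eq_1 by auto

lemma M_pos: "M > 0"
  using fin nonempty pos by (simp add: M_def sum_pos)

text \<open>The function \<open>G\<close> of the introduction, with \<open>dilation_defect\<close> for \<open>\<psi>\<close>.\<close>

definition gain :: "nat \<Rightarrow> real \<Rightarrow> real" where
  "gain k x = (\<Sum>i\<in>I. dilation_defect k (real (m i) * x) / real (m i))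
     - dilation_defect k (real M * x) / real M"

text \<open>M divides every \<open>C * m i\<close>, hence also their gcd, which is |C| because the
  \<open>m i\<close> have gcd 1.\<close>

lemma M_dvd_if_proportional:
  fixes c :: "'a \<Rightarrow> int"
  assumes "\<And>i. i \<in> I \<Longrightarrow> c i * int M = C * int (m i)"
  shows "int M dvd C"
proof -
  have "M dvd nat \<bar>C\<bar> * m i" if "i \<in> I" for i
  proof -
    have "int M dvd C * int (m i)" using assms[OF that] by (metis dvd_triv_right)
    then have "int M dvd \<bar>C * int (m i)\<bar>" by simp
    also have "\<bar>C * int (m i)\<bar> = int (nat \<bar>C\<bar> * m i)" by (simp add: abs_mult)
    finally show ?thesis by (simp only: int_dvd_int_iff)
  qed
  then have "M dvd Gcd ((*) (nat \<bar>C\<bar>) ` (m ` I))"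
    by (intro Gcd_greatest) auto
  then have "M dvd nat \<bar>C\<bar>"
    using Gcd_eq_1 by (simp add: Gcd_mult del: image_image)
  then show ?thesis by (simp add: int_dvd_int_iff[symmetric])
qed

text \<open>With optimal vectors for the \<open>m i * x\<close> and their sum as competitor at
  \<open>M * x\<close>, the gain is a sum of nonnegative terms. If all vanish, \<open>M * x\<close>
  is within 1 / k of a multiple of M, whereas its distance to such multiples is at least 1.\<close>

lemma gain_pos:
  assumes "k \<ge> 2" "M \<ge> 2" "1 \<le> real M * x" "real M * x \<le> real M - 1"
  shows "gain k x > 0"
proof (rule ccontr)
  assume not_pos: "\<not> gain k x > 0"
  let ?R = "{1..<k}"
  have k1: "k \<ge> 1" using assms by simp
  have "\<forall>i. \<exists>c :: nat \<Rightarrow> int. dilation_defect k (real (m i) * x)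
      = (of_int ((\<Sum>r\<in>?R. c r)\<^sup>2) + (\<Sum>r\<in>?R. of_int ((c r)\<^sup>2))) / 2
       - of_int (\<Sum>r\<in>?R. c r) * real k * (real (m i) * x)"
    using dilation_defect_attained[OF k1] by metis
  then obtain c :: "'a \<Rightarrow> nat \<Rightarrow> int" where
    c: "\<And>i. dilation_defect k (real (m i) * x)
      = (of_int ((\<Sum>r\<in>?R. c i r)\<^sup>2) + (\<Sum>r\<in>?R. of_int ((c i r)\<^sup>2))) / 2
       - of_int (\<Sum>r\<in>?R. c i r) * real k * (real (m i) * x)"
    by (auto dest: choice)
  define n where "n i = (\<Sum>r\<in>?R. c i r)" for i
  \<comment> \<open>\<open>C\<close> need not be optimal at \<open>M * x\<close>; \<open>G1\<close>
    and \<open>G2\<close> measure its slack, and \<open>V\<close> is the Cauchy--Schwarz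
    remainder.\<close>
  define C where "C r = (\<Sum>i\<in>I. c i r)" for r
  define nC where "nC = (\<Sum>r\<in>?R. C r)"
  define l where "l = \<lfloor>real M * x\<rfloor>"
  define G1 where "G1 = (\<Sum>r\<in>?R. real_of_int ((C r - l) * (C r - l - 1)))"
  define G2 where "G2 = floor_int (real k * (real M * x))
         - (of_int (nC + l) * (real k * (real M * x)) - of_int (nC + l) * (of_int (nC + l) + 1) / 2)"
  define V where "V b = (\<Sum>i\<in>I. (of_int (b i))\<^sup>2 / real (m i)) - (of_int (sum b I))\<^sup>2 / real M"
    for b :: "'a \<Rightarrow> int"
  have nC: "nC = sum n I"
    unfolding nC_def C_def n_def by (rule sum.swap)
  have V: "V b = (\<Sum>i\<in>I. real (m i) * (of_int (b i) / real (m i) - of_int (sum b I) / real M)\<^sup>2)" for b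
    using sum_square_div_eq[of I "\<lambda>i. real (m i)" "\<lambda>i. of_int (b i)"] fin pos nonempty
    by (simp add: V_def M_def)
  have V_nonneg: "V b \<ge> 0" for b
    unfolding V by (intro sum_nonneg) simp
  have G1_term: "real_of_int ((C r - l) * (C r - l - 1)) \<ge> 0" for r
  proof -
    have "(C r - l) * (C r - l - 1) \<ge> 0"
    proof (cases "C r - l \<ge> 1")
      case False
      then show ?thesis by (intro mult_nonpos_nonpos) auto
    qed simp
    then show ?thesis by (simp only: of_int_0_le_iff)
  qed
  then have G1: "G1 \<ge> 0"
    unfolding G1_def by (intro sum_nonneg)
  have G2: "G2 \<ge> 0"
    using floor_int_ge[of "nC + l" "real k * (real M * x)"] by (simp add: G2_def)
  have M: "dilation_defect k (real M * x)
      = (of_int nC ^ 2 + (\<Sum>r\<in>?R. (of_int (C r))\<^sup>2)) / 2 - of_int nC * real k * (real M * x) - G1 / 2 - G2"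
    using dilation_defect_eq[OF k1, of C "real M * x"]
    unfolding nC_def[symmetric] l_def[symmetric] G1_def[symmetric] G2_def[symmetric] by simp
  have "(\<Sum>i\<in>I. dilation_defect k (real (m i) * x) / real (m i))
      = (\<Sum>i\<in>I. ((of_int (n i))\<^sup>2 / real (m i)) / 2
         + (\<Sum>r\<in>?R. (of_int (c i r))\<^sup>2 / real (m i)) / 2 - real k * x * of_int (n i))"
  proof (intro sum.cong refl)
    fix i assume "i \<in> I"
    then have "real (m i) > 0" using pos by simp
    then show "dilation_defect k (real (m i) * x) / real (m i)
      = ((of_int (n i))\<^sup>2 / real (m i)) / 2
         + (\<Sum>r\<in>?R. (of_int (c i r))\<^sup>2 / real (m i)) / 2 - real k * x * of_int (n i)"
      unfolding c[of i] n_def[symmetric] sum_divide_distrib[symmetric] by (simp add: field_simps)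
  qed
  also have "\<dots> = (\<Sum>i\<in>I. (of_int (n i))\<^sup>2 / real (m i)) / 2
      + (\<Sum>r\<in>?R. \<Sum>i\<in>I. (of_int (c i r))\<^sup>2 / real (m i)) / 2 - real k * x * of_int nC"
    unfolding nC
    by (subst sum.swap) (simp add: sum.distrib sum_subtractf sum_distrib_left sum_divide_distrib)
  finally have S: "(\<Sum>i\<in>I. dilation_defect k (real (m i) * x) / real (m i)) = \<dots>" .
  \<comment> \<open>The terms linear in x cancel, since the entries of all \<open>c i\<close>
    together sum to \<open>nC\<close>.\<close>
  have "gain k x = V n / 2 + (\<Sum>r\<in>?R. V (\<lambda>i. c i r)) / 2 + G1 / (2 * real M) + G2 / real M"
    unfolding gain_def S M V_def C_def[symmetric] nC[symmetric]
    using M_pos by (simp add: sum_subtractf sum_divide_distrib[symmetric] field_simps)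
      (simp add: sum_distrib_left)
  moreover have "G1 / (2 * real M) \<ge> 0" "G2 / real M \<ge> 0" "(\<Sum>r\<in>?R. V (\<lambda>i. c i r)) \<ge> 0"
    using G1 G2 V_nonneg by (auto intro: sum_nonneg)
  ultimately have "G1 / (2 * real M) = 0" "G2 / real M = 0" "(\<Sum>r\<in>?R. V (\<lambda>i. c i r)) = 0"
    using V_nonneg[of n] not_pos by linarith+
  then have G1_0: "G1 = 0" and G2_0: "G2 = 0" and "\<forall>r\<in>?R. V (\<lambda>i. c i r) = 0"
    using M_pos V_nonneg by (auto simp: sum_nonneg_eq_0_iff)
  have dvd: "int M dvd C r" if "r \<in> ?R" for r
  proof (rule M_dvd_if_proportional[of "\<lambda>i. c i r"])
    fix i assume i: "i \<in> I"
    have "V (\<lambda>i. c i r) = 0" using that \<open>\<forall>r\<in>?R. _ r\<close> by blast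
    then have "real (m i) * (of_int (c i r) / real (m i) - of_int (C r) / real M)\<^sup>2 = 0"
      unfolding V C_def using i fin by (subst (asm) sum_nonneg_eq_0_iff) auto
    then have "of_int (c i r) * real M = of_int (C r) * real (m i)"
      using pos[OF i] M_pos by (simp add: field_simps)
    then have "real_of_int (c i r * int M) = real_of_int (C r * int (m i))" by simp
    then show "c i r * int M = C r * int (m i)" by (simp only: of_int_eq_iff)
  qed
  have C_l: "C r = l \<or> C r = l + 1" if "r \<in> ?R" for r
  proof -
    have "real_of_int ((C r - l) * (C r - l - 1)) = 0"
      using G1_0 G1_term that unfolding G1_def by (subst (asm) sum_nonneg_eq_0_iff) auto
    then have "(C r - l) * (C r - l - 1) = 0" by (simp only: of_int_eq_0_iff)
    then show ?thesis by auto
  qed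
  have "1 \<in> ?R" using assms by simp
  \<comment> \<open>Two multiples of M >= 2 that differ by at most 1 are equal.\<close>
  have C_eq: "C r = C 1" if "r \<in> ?R" for r
  proof -
    have "int M dvd C r - C 1" using dvd that \<open>1 \<in> ?R\<close> by simp
    moreover have "\<bar>C r - C 1\<bar> \<le> 1" using C_l[OF that] C_l[OF \<open>1 \<in> ?R\<close>] by linarith
    ultimately show ?thesis using assms(2) dvd_imp_le_int[of "C r - C 1" "int M"] by linarith
  qed
  have "nC = (\<Sum>r\<in>?R. C 1)"
    unfolding nC_def by (intro sum.cong refl C_eq)
  then have "nC = (int k - 1) * C 1"
    using k1 by (simp add: of_nat_diff)
  then have "real_of_int nC = (real k - 1) * of_int (C 1)" by simp
  moreover have "real_of_int (nC + l) \<le> real k * (real M * x) \<and> real k * (real M * x) \<le> real_of_int (nC + l) + 1"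
    using G2_0 by (intro floor_int_eqD) (simp add: G2_def)
  moreover have "real_of_int (C 1) = of_int l \<or> real_of_int (C 1) = of_int l + 1"
    using C_l[OF \<open>1 \<in> ?R\<close>] by auto
  \<comment> \<open>Since \<open>nC + l\<close> is k C(1) or k C(1) - 1, the interval from
    \<open>nC + l\<close> to \<open>nC + l + 1\<close> stays within 1 of k C(1).\<close>
  ultimately have b: "real k * of_int (C 1) - 1 \<le> real k * (real M * x)"
     "real k * (real M * x) \<le> real k * of_int (C 1) + 1"
    by (auto simp: algebra_simps)
  obtain z where z: "C 1 = int M * z" using dvd[OF \<open>1 \<in> ?R\<close>] by blast
  have x: "real k * 1 \<le> real k * (real M * x)" "real k * (real M * x) \<le> real k * (real M - 1)"
    by (intro mult_left_mono; use assms in simp)+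
  have k2: "real k \<ge> 2" using assms(1) by simp
  show False
  proof (cases "z \<le> 0")
    case True
    then have "C 1 \<le> 0" unfolding z by (intro mult_nonneg_nonpos) auto
    then have "real k * of_int (C 1) \<le> 0" by (intro mult_nonneg_nonpos) auto
    with b(2) x(1) k2 show False by linarith
  next
    case False
    then have "int M * 1 \<le> C 1" unfolding z by (intro mult_left_mono) auto
    then have "real M \<le> of_int (C 1)" by linarith
    then have "real k * real M \<le> real k * of_int (C 1)" by (intro mult_left_mono) auto
    with b(1) x(2) k2 show False unfolding right_diff_distrib by linarith
  qed
qed

text \<open>A continuous positive function on a compact interval has a positive minimum; M >= 2
  makes the interval nonempty.\<close>

lemma gain_bounded_below:
  assumes "k \<ge> 2" "M \<ge> 2"
  obtains \<delta> where "\<delta> > 0"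
    "\<And>x. 1 \<le> real M * x \<Longrightarrow> real M * x \<le> real M - 1 \<Longrightarrow> \<delta> \<le> gain k x"
proof -
  let ?S = "{1 / real M .. (real M - 1) / real M}"
  have S: "x \<in> ?S \<longleftrightarrow> 1 \<le> real M * x \<and> real M * x \<le> real M - 1" for x
    using M_pos by (auto simp: field_simps)
  have "?S \<noteq> {}" using assms M_pos by (auto simp: field_simps)
  moreover have "continuous_on ?S (gain k)"
    unfolding gain_def dilation_defect_def
    by (intro continuous_intros continuous_on_compose2[OF continuous_floor_int])
       (use pos M_pos in auto)
  ultimately obtain y where "y \<in> ?S" "\<forall>x\<in>?S. gain k y \<le> gain k x"
    using continuous_attains_inf[of ?S "gain k"] by auto
  with that[of "gain k y"] gain_pos[OF assms] S show ?thesis by blast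
qed

end

section \<open>The excess modulo a prime power\<close>

context coprime_parts
begin

text \<open>The value \<open>f (n / q)\<close> of the introduction.\<close>

definition carry :: "nat \<Rightarrow> nat \<Rightarrow> int" where
  "carry q n = int (M * n div q) - (\<Sum>i\<in>I. int (m i * n div q))"

lemma carry_periodic:
  assumes "q > 0"
  shows "carry q (n + q) = carry q n"
proof -
  have "a * (n + q) div q = a * n div q + a" for a
    using assms by (simp add: distrib_left)
  then show ?thesis by (simp add: carry_def sum.distrib M_def)
qed

lemma carry_mod:
  assumes "q > 0"
  shows "carry q (n mod q) = carry q n"
proof -
  have "carry q (r + a * q) = carry q r" for r a
  proof (induction a)
    case (Suc a)
    then show ?case using carry_periodic[OF assms, of "r + a * q"] by (simp add: algebra_simps)
  qed simp
  from this[of "n mod q" "n div q"] show ?thesis by simp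
qed

lemma carry_nonneg:
  assumes "q > 0"
  shows "carry q n \<ge> 0"
proof -
  have "(\<Sum>i\<in>I. m i * n div q) * q \<le> M * n"
    unfolding M_def sum_distrib_right by (intro sum_mono) simp
  then have "(\<Sum>i\<in>I. m i * n div q) \<le> M * n div q"
    using assms by (simp add: less_eq_div_iff_mult_less_eq)
  then have "int (\<Sum>i\<in>I. m i * n div q) \<le> int (M * n div q)" by (simp only: of_nat_le_iff)
  then show ?thesis by (simp add: carry_def)
qed

text \<open>Each \<open>m i * n / q\<close> is less than its floor plus 1, so all floors together
  lose less than |I|.\<close>

lemma carry_less_card:
  assumes "q > 0"
  shows "carry q n < int (card I)"
proof -
  have "M * n < (\<Sum>i\<in>I. (m i * n div q + 1) * q)"
    unfolding M_def sum_distrib_right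
  proof (intro sum_strict_mono fin nonempty)
    fix i
    show "m i * n < (m i * n div q + 1) * q"
      using div_less_iff_less_mult[OF assms, of "m i * n" "m i * n div q + 1"] by simp
  qed
  also have "\<dots> = ((\<Sum>i\<in>I. m i * n div q) + card I) * q"
    by (simp only: sum_distrib_right[symmetric] sum.distrib) simp
  finally have "M * n div q < (\<Sum>i\<in>I. m i * n div q) + card I"
    using assms by (simp add: div_less_iff_less_mult)
  then have "int (M * n div q) < int ((\<Sum>i\<in>I. m i * n div q) + card I)" by (simp only: of_nat_less_iff)
  then show ?thesis by (simp add: carry_def)
qed

lemma carry_eq_0:
  assumes "M * n < q"
  shows "carry q n = 0"
  using carry_nonneg[of q n] assms by (simp add: carry_def sum_nonneg antisym)

text \<open>For n / q in [1 - 1 / M, 1) the first floor is at least M - 1 and each other one at most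
  \<open>m i - 1\<close>. With \<open>carry_less_card\<close> this is the maximal value.\<close>

lemma carry_ge_card:
  assumes "n < q" "M * (q - n) \<le> q"
  shows "carry q n \<ge> int (card I) - 1"
proof -
  have "(M - 1) * q \<le> M * n" using assms by (simp add: diff_mult_distrib diff_mult_distrib2)
  then have "M - 1 \<le> M * n div q" using assms by (simp add: less_eq_div_iff_mult_less_eq)
  moreover have "(\<Sum>i\<in>I. int (m i * n div q)) \<le> (\<Sum>i\<in>I. int (m i) - 1)"
  proof (intro sum_mono)
    fix i assume "i \<in> I"
    then have "m i * n < m i * q" using assms pos by simp
    then have "m i * n div q < m i" using assms by (simp add: div_less_iff_less_mult)
    then show "int (m i * n div q) \<le> int (m i) - 1" by linarith
  qed
  moreover have "(\<Sum>i\<in>I. int (m i) - 1) = int M - int (card I)"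
    by (simp add: sum_subtractf M_def)
  ultimately show ?thesis using M_pos unfolding carry_def by linarith
qed

text \<open>The term n = 0 vanishes, so \<open>excess k q (Suc t)\<close> is the sum over 1, ..., t;
  starting at 0 makes a full period the range below q.\<close>

definition excess :: "nat \<Rightarrow> nat \<Rightarrow> nat \<Rightarrow> int" where
  "excess k q T = (\<Sum>n<T. carry q (k * n) - carry q n)"

text \<open>Multiplication by k permutes the residues modulo q.\<close>

lemma excess_full_period:
  assumes "coprime k q" "q > 0"
  shows "excess k q q = 0"
proof -
  have inj: "inj_on (\<lambda>n. k * n mod q) {..<q}"
  proof (rule inj_onI)
    fix a b assume ab: "a \<in> {..<q}" "b \<in> {..<q}" "k * a mod q = k * b mod q"
    then have "[a = b] (mod q)"
      using cong_mult_lcancel_nat[OF assms(1)] by (simp add: cong_def)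
    then show "a = b" using ab by (simp add: cong_def)
  qed
  have "(\<lambda>n. k * n mod q) ` {..<q} = {..<q}"
    by (rule endo_inj_surj[OF _ _ inj]) (use assms in auto)
  with inj have "(\<Sum>n<q. carry q n) = (\<Sum>n<q. carry q (k * n mod q))"
    by (metis (no_types, lifting) sum.reindex_cong)
  then show ?thesis by (simp add: excess_def sum_subtractf carry_mod[OF assms(2)])
qed

lemma excess_mod:
  assumes "coprime k q" "q > 0"
  shows "excess k q (T mod q) = excess k q T"
proof -
  have step: "excess k q (q + T) = excess k q T" for T
  proof (induction T)
    case 0
    show ?case using excess_full_period[OF assms] by (simp add: excess_def)
  next
    case (Suc T)
    have "carry q (q + T) = carry q T" "carry q (k * (q + T)) = carry q (k * T)"
      using assms(2) by (subst (1 2) carry_mod[symmetric]; simp add: distrib_left)+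
    with Suc show ?case by (simp add: excess_def)
  qed
  have "excess k q (a * q + r) = excess k q r" for a r
    using step by (induction a) (simp_all add: add.assoc)
  from this[of "T div q" "T mod q"] show ?thesis by simp
qed

text \<open>After reduction modulo q fewer than q terms remain, each at least -|I|. This crude bound
  serves for the small prime powers.\<close>

lemma excess_ge:
  assumes "coprime k q" "q > 0"
  shows "excess k q T \<ge> - int (card I * q)"
proof -
  have "(\<Sum>n<T mod q. - int (card I)) \<le> excess k q (T mod q)"
    unfolding excess_def
  proof (intro sum_mono)
    fix n
    show "- int (card I) \<le> carry q (k * n) - carry q n"
      using carry_nonneg[OF assms(2), of "k * n"] carry_less_card[OF assms(2), of n] by linarith
  qed
  moreover have "int (T mod q) * int (card I) \<le> int q * int (card I)"
    using assms(2) by (intro mult_right_mono) (auto simp: less_imp_le)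
  ultimately show ?thesis using excess_mod[OF assms, of T] by (simp add: mult.commute)
qed

text \<open>Each floor sum \<open>S a\<close> exceeds its integral \<open>\<Phi> a\<close> by at
  most a. Only the sums entering with a minus sign cost anything: k M from the
  \<open>k * m i\<close> and M from \<open>M\<close> itself.\<close>

lemma excess_ge_gain:
  assumes "k > 0" "t < q"
  shows "real_of_int (excess k q (Suc t)) \<ge>
    real q / real k * gain k (real t / real q) - (real k + 1) * real M"
proof -
  define S where "S a = (\<Sum>n=1..t. real (a * n div q))" for a
  \<comment> \<open>The integral of the floor of a x / q over x from 0 to t, rescaled.\<close>
  define \<Phi> where "\<Phi> a = floor_int (real a * (real t / real q)) * real q / real a" for a
  have q: "real q > 0" using assms by simp
  have fl: "real (a * n div q) = of_int \<lfloor>real n * (real a / real q)\<rfloor>" for a n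
    using floor_divide_of_nat_eq[of "a * n" q, where ?'a = real] by (simp add: mult.commute)
  have lower: "S a \<ge> \<Phi> a" if "a > 0" for a
    using sum_floor_ge[of "real a / real q" t] that q
    unfolding S_def fl \<Phi>_def by (simp add: field_simps)
  have upper: "S a \<le> \<Phi> a + real a" if "a > 0" for a
  proof -
    have "S a \<le> \<Phi> a + \<lfloor>real t * (real a / real q)\<rfloor>"
      using sum_floor_le[of "real a / real q" t] that q
      unfolding S_def fl \<Phi>_def by (simp add: field_simps)
    also have "\<lfloor>real t * (real a / real q)\<rfloor> \<le> real t * (real a / real q)" by simp
    also have "\<dots> \<le> real a" using assms q by (simp add: field_simps mult_left_mono)
    finally show ?thesis by simp
  qed
  have c: "real_of_int (\<Sum>n<Suc t. carry q (b * n)) = S (b * M) - (\<Sum>i\<in>I. S (b * m i))" for b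
  proof -
    have "{..<Suc t} = insert 0 {1..t}" by auto
    then have "real_of_int (\<Sum>n<Suc t. carry q (b * n)) =
       (\<Sum>n=1..t. real (b * M * n div q) - (\<Sum>i\<in>I. real (b * m i * n div q)))"
      by (simp add: carry_def ac_simps)
    also have "\<dots> = S (b * M) - (\<Sum>i\<in>I. S (b * m i))"
      unfolding S_def sum_subtractf by (subst sum.swap) simp
    finally show ?thesis .
  qed
  have "real_of_int (excess k q (Suc t))
      = S (k * M) - (\<Sum>i\<in>I. S (k * m i)) - (S M - (\<Sum>i\<in>I. S (m i)))"
    using c[of k] c[of 1] by (simp only: excess_def sum_subtractf of_int_diff mult_1)
  also have "\<dots> \<ge> \<Phi> (k * M) - (\<Sum>i\<in>I. \<Phi> (k * m i) + real (k * m i)) - ((\<Phi> M + real M) - (\<Sum>i\<in>I. \<Phi> (m i)))"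
    using assms pos M_pos by (intro diff_mono lower upper sum_mono) auto
  also have "\<Phi> (k * M) - (\<Sum>i\<in>I. \<Phi> (k * m i) + real (k * m i)) - ((\<Phi> M + real M) - (\<Sum>i\<in>I. \<Phi> (m i)))
     = real q / real k * gain k (real t / real q) - (real k + 1) * real M"
  proof -
    have "real q / real k * (dilation_defect k (real a * (real t / real q)) / real a)
        = \<Phi> a - \<Phi> (k * a)" if "a > 0" for a
      using assms that by (simp add: dilation_defect_def \<Phi>_def field_simps)
    then have g: "real q / real k * gain k (real t / real q)
        = (\<Sum>i\<in>I. \<Phi> (m i) - \<Phi> (k * m i)) - (\<Phi> M - \<Phi> (k * M))"
      using pos M_pos unfolding gain_def right_diff_distrib sum_distrib_left by simp
    have "(\<Sum>i\<in>I. real (k * m i)) = real k * real M"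
      by (simp add: M_def sum_distrib_left)
    then show ?thesis unfolding g by (simp add: sum.distrib sum_subtractf algebra_simps)
  qed
  finally show ?thesis .
qed

lemma card_le_M: "card I \<le> M"
  unfolding M_def card_eq_sum using pos by (intro sum_mono) (simp add: Suc_leI)

text \<open>If k = 1 the excess is 0; if M = 1 there is a single part and every carry is 0.
  Otherwise t / q is near 0, near 1, or in the range where the gain is bounded below.\<close>

lemma excess_eventually_nonneg:
  assumes "k > 0"
  shows "\<exists>Q. \<forall>q\<ge>Q. coprime k q \<longrightarrow> (\<forall>T. excess k q T \<ge> 0)"
proof (cases "k \<ge> 2 \<and> M \<ge> 2")
  case False
  have "excess k q T \<ge> 0" if "q \<ge> 1" for q T
  proof (cases "k = 1")
    case False
    with \<open>\<not> (k \<ge> 2 \<and> M \<ge> 2)\<close> assms have "card I \<le> 1" using card_le_M by linarith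
    then have "carry q n = 0" for n
      using carry_nonneg[of q n] carry_less_card[of q n] that by linarith
    then show ?thesis by (simp add: excess_def)
  qed (simp add: excess_def)
  then show ?thesis by blast
next
  case True
  obtain \<delta> where \<delta>: "\<delta> > 0"
    "\<And>x. 1 \<le> real M * x \<Longrightarrow> real M * x \<le> real M - 1 \<Longrightarrow> \<delta> \<le> gain k x"
    using gain_bounded_below True by blast
  \<comment> \<open>Large enough that q \<delta> / k absorbs the error (k + 1) M of
    \<open>excess_ge_gain\<close>.\<close>
  define Q where "Q = nat \<lceil>real k * (real k + 1) * real M / \<delta>\<rceil> + 1"
  have "excess k q T \<ge> 0" if q: "q \<ge> Q" and cop: "coprime k q" for q T
  proof -
    have q0: "q > 0" using q by (simp add: Q_def)
    have large: "real k * (real k + 1) * real M \<le> real q * \<delta>"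
    proof -
      have "real k * (real k + 1) * real M / \<delta> \<le> real q" using q unfolding Q_def by linarith
      then show ?thesis using \<delta>(1) by (simp add: field_simps)
    qed
    have "excess k q (T mod q) \<ge> 0"
    proof (cases "T mod q")
      case 0
      then show ?thesis by (simp add: excess_def)
    next
      case (Suc t)
      have t: "Suc t \<le> q" using Suc mod_less_divisor[OF q0, of T] by simp
      consider "M * t < q" | "M * (q - t) < q" | "q \<le> M * t" "q \<le> M * (q - t)" by linarith
      then show ?thesis
      proof cases
        case 1
        have "carry q n = 0" if "n < Suc t" for n
        proof (rule carry_eq_0)
          have "M * n \<le> M * t" using that by simp
          with 1 show "M * n < q" by linarith
        qed
        then show ?thesis
          unfolding Suc excess_def by (intro sum_nonneg) (simp add: carry_nonneg[OF q0])
      next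
        case 2
        \<comment> \<open>From t on \<open>carry q n\<close> is maximal, so the rest of the period
          contributes at most 0, while the whole period sums to 0.\<close>
        have "carry q (k * n) - carry q n \<le> 0" if "n \<in> {Suc t..<q}" for n
        proof -
          have "M * (q - n) \<le> M * (q - t)" using that by (intro mult_left_mono) auto
          with 2 carry_ge_card[of n q] carry_less_card[OF q0, of "k * n"] that
          show ?thesis by force
        qed
        then have "(\<Sum>n\<in>{Suc t..<q}. carry q (k * n) - carry q n) \<le> 0"
          by (intro sum_nonpos)
        moreover have "excess k q q = excess k q (Suc t) + (\<Sum>n\<in>{Suc t..<q}. carry q (k * n) - carry q n)"
          unfolding excess_def lessThan_atLeast0 using t by (subst sum.atLeastLessThan_concat) auto
        ultimately show ?thesis unfolding Suc using excess_full_period[OF cop q0] by linarith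
      next
        case 3
        have "real q \<le> real M * real t" using 3(1) by (metis of_nat_le_iff of_nat_mult)
        moreover have "real q \<le> real M * (real q - real t)"
          using 3(2) t by (metis Suc_leD of_nat_diff of_nat_le_iff of_nat_mult)
        ultimately have "\<delta> \<le> gain k (real t / real q)"
          using q0 by (intro \<delta>(2)) (auto simp: field_simps)
        then have "real q / real k * \<delta> \<le> real q / real k * gain k (real t / real q)"
          by (intro mult_left_mono) auto
        moreover have "real q / real k * \<delta> \<ge> (real k + 1) * real M"
          using large assms by (simp add: field_simps)
        ultimately have "real_of_int (excess k q (Suc t)) \<ge> 0"
          using excess_ge_gain[OF assms, of t q] t by linarith
        then show ?thesis by (simp add: Suc)
      qed
    qed
    then show ?thesis using excess_mod[OF cop q0] by simp
  qed
  then show ?thesis by blast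
qed

end

section \<open>Valuations of multinomial coefficients\<close>

lemma sum_of_bool_power_dvd:
  fixes p N J :: nat
  assumes "prime p" "N > 0" "N \<le> J"
  shows "(\<Sum>j=1..J. of_bool (p ^ j dvd N)) = multiplicity p N"
proof -
  have "p ^ multiplicity p N \<le> N" using assms by (intro dvd_imp_le multiplicity_dvd) auto
  moreover have "multiplicity p N < p ^ multiplicity p N"
    using assms(1) by (intro power_gt_expt) (simp add: prime_gt_Suc_0_nat)
  ultimately have "multiplicity p N \<le> J" using assms(3) by linarith
  moreover have "p ^ j dvd N \<longleftrightarrow> j \<le> multiplicity p N" for j
    using assms by (intro power_dvd_iff_le_multiplicity) (auto simp: prime_gt_Suc_0_nat)
  ultimately have "{1..J} \<inter> {j. p ^ j dvd N} = {1..multiplicity p N}"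
    by (simp only: set_eq_iff Int_iff mem_Collect_eq atLeastAtMost_iff) (metis le_trans)
  then show ?thesis
    by (subst sum_of_bool_eq) simp_all
qed

text \<open>Legendre's formula: passing from N to N + 1 raises the quotient by p^j exactly when p^j
  divides N + 1. A free cutoff J lets different factorials share one range.\<close>

lemma multiplicity_fact:
  fixes p N J :: nat
  assumes "prime p" "N \<le> J"
  shows "multiplicity p (fact N) = (\<Sum>j=1..J. N div p ^ j)"
  using assms(2)
proof (induction N)
  case (Suc N)
  have "multiplicity p (fact (Suc N)) = multiplicity p (Suc N) + multiplicity p (fact N)"
    using assms(1) by (simp add: prime_elem_multiplicity_mult_distrib del: mult_Suc)
  also have "\<dots> = (\<Sum>j=1..J. of_bool (p ^ j dvd Suc N) + N div p ^ j)"
    using Suc sum_of_bool_power_dvd[OF assms(1), of "Suc N" J] by (simp add: sum.distrib)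
  also have "\<dots> = (\<Sum>j=1..J. Suc N div p ^ j)"
    by (intro sum.cong) (auto simp: div_Suc dvd_eq_mod_eq_0)
  finally show ?case .
qed simp

lemma prod_fact_dvd_fact_sum:
  assumes "finite I"
  shows "(\<Prod>i\<in>I. fact (a i)) dvd (fact (sum a I) :: nat)"
  using assms
proof (induction I)
  case (insert i I)
  have "fact (a i) * (\<Prod>i\<in>I. fact (a i)) dvd fact (a i) * (fact (sum a I) :: nat)"
    using insert.IH by (intro mult_dvd_mono) auto
  also have "\<dots> dvd fact (a i + sum a I)" by (rule fact_fact_dvd_fact)
  finally show ?case using insert.hyps by simp
qed simp

context coprime_parts
begin

definition multinom :: "nat \<Rightarrow> nat" where
  "multinom n = fact (M * n) div (\<Prod>i\<in>I. fact (m i * n))"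

lemma multinom_mult: "multinom n * (\<Prod>i\<in>I. fact (m i * n)) = fact (M * n)"
  using prod_fact_dvd_fact_sum[OF fin, of "\<lambda>i. m i * n"]
  by (simp add: multinom_def M_def sum_distrib_right)

lemma multinom_pos: "multinom n > 0"
  using multinom_mult[of n] by (metis fact_nonzero gr0I mult_0)

lemma multiplicity_multinom:
  assumes "prime p" "M * n \<le> J"
  shows "int (multiplicity p (multinom n)) = (\<Sum>j=1..J. carry (p ^ j) n)"
proof -
  have nz: "(\<Prod>i\<in>I. fact (m i * n)) \<noteq> (0::nat)" using fin by simp
  have "m i * n \<le> J" if "i \<in> I" for i
  proof -
    have "m i \<le> M" using that fin member_le_sum[of i I m] by (simp add: M_def)
    then have "m i * n \<le> M * n" by (rule mult_le_mono1)
    then show ?thesis using assms(2) by (rule le_trans)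
  qed
  then have "multiplicity p (\<Prod>i\<in>I. fact (m i * n)) = (\<Sum>i\<in>I. \<Sum>j=1..J. m i * n div p ^ j)"
    using assms(1) fin
    by (subst prime_elem_multiplicity_prod_distrib) (auto intro!: sum.cong multiplicity_fact simp del: One_nat_def)
  moreover have "multiplicity p (multinom n) + multiplicity p (\<Prod>i\<in>I. fact (m i * n))
     = multiplicity p (fact (M * n))"
    using assms(1) multinom_pos[of n] nz multinom_mult[of n]
    by (metis gr_implies_not0 prime_elem_multiplicity_mult_distrib prime_imp_prime_elem)
  ultimately have "int (multiplicity p (multinom n))
     = int (\<Sum>j=1..J. M * n div p ^ j) - int (\<Sum>i\<in>I. \<Sum>j=1..J. m i * n div p ^ j)"
    unfolding multiplicity_fact[OF assms] by linarith
  also have "\<dots> = (\<Sum>j=1..J. carry (p ^ j) n)"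
    unfolding carry_def sum_subtractf by (subst sum.swap) simp
  finally show ?thesis .
qed

text \<open>The term j = 1 vanishes because p divides the argument, and the later terms are those
  for n shifted by one.\<close>

lemma multiplicity_multinom_times_prime:
  assumes "prime p"
  shows "multiplicity p (multinom (p * n)) = multiplicity p (multinom n)"
proof -
  have p: "p > 0" using assms by (simp add: prime_gt_0_nat)
  define J where "J = M * (p * n)"
  have J: "M * n \<le> J" unfolding J_def using p by simp
  have "carry p (p * n) = 0"
    using p by (simp add: carry_def mult.left_commute[of _ p] M_def sum_distrib_right)
  moreover have "carry (p ^ Suc j) (p * n) = carry (p ^ j) n" for j
    using p by (simp add: carry_def mult.left_commute[of _ p])
  moreover have "(\<Sum>j=1..Suc J. g j) = g 1 + (\<Sum>j=1..J. g (Suc j))" for g :: "nat \<Rightarrow> int"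
    by (simp add: sum.atLeast_Suc_atMost sum.shift_bounds_cl_Suc_ivl del: sum.cl_ivl_Suc)
  ultimately have "(\<Sum>j=1..Suc J. carry (p ^ j) (p * n)) = (\<Sum>j=1..J. carry (p ^ j) n)"
    by (simp only: power_one_right)
  then show ?thesis
    using multiplicity_multinom[OF assms, of "p * n" "Suc J"] multiplicity_multinom[OF assms J]
    by (simp add: J_def)
qed

lemma multiplicity_multinom_times_prime_power:
  assumes "prime p"
  shows "multiplicity p (multinom (p ^ e * n)) = multiplicity p (multinom n)"
  by (induction e) (simp_all add: mult.assoc multiplicity_multinom_times_prime[OF assms])

lemma multiplicity_prod_multinom:
  assumes "prime p" "M * k * t \<le> J" "k > 0"
  shows "int (multiplicity p (\<Prod>n=1..t. multinom (k * n))) - int (multiplicity p (\<Prod>n=1..t. multinom n))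
    = (\<Sum>j=1..J. excess k (p ^ j) (Suc t))"
proof -
  have mp: "multiplicity p (\<Prod>n=1..t. multinom (b * n)) = (\<Sum>n=1..t. multiplicity p (multinom (b * n)))"
    for b
    using assms(1) multinom_pos by (intro prime_elem_multiplicity_prod_distrib) (auto simp: image_iff less_not_refl3)
  have mm: "int (multiplicity p (\<Prod>n=1..t. multinom (b * n)))
     = (\<Sum>j=1..J. \<Sum>n<Suc t. carry (p ^ j) (b * n))" if "b \<le> k" for b
  proof -
    have "M * (b * n) \<le> J" if "n \<in> {1..t}" for n
    proof -
      have "M * b * n \<le> M * k * t" using that \<open>b \<le> k\<close> by (intro mult_le_mono) auto
      also note assms(2)
      finally show ?thesis by (simp only: mult.assoc)
    qed
    then have "int (multiplicity p (\<Prod>n=1..t. multinom (b * n)))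
       = (\<Sum>n=1..t. \<Sum>j=1..J. carry (p ^ j) (b * n))"
      unfolding mp of_nat_sum by (intro sum.cong multiplicity_multinom assms(1)) auto
    also have "\<dots> = (\<Sum>j=1..J. \<Sum>n=1..t. carry (p ^ j) (b * n))" by (rule sum.swap)
    also have "\<dots> = (\<Sum>j=1..J. \<Sum>n<Suc t. carry (p ^ j) (b * n))"
    proof (rule sum.cong[OF refl])
      fix j
      have "{..<Suc t} = insert 0 {1..t}" by auto
      then show "(\<Sum>n=1..t. carry (p ^ j) (b * n)) = (\<Sum>n<Suc t. carry (p ^ j) (b * n))"
        by (simp add: carry_def)
    qed
    finally show ?thesis .
  qed
  from mm[of k] mm[of 1] assms(3) show ?thesis
    by (simp only: excess_def sum_subtractf mult_1)
qed

text \<open>The comparison is made prime by prime with k replaced by its part b prime to p. Only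
  prime powers below a bound independent of t can lose anything.\<close>

lemma prod_multinom_dvd:
  assumes "k > 0"
  shows "\<exists>c>0. \<forall>t. (\<Prod>n=1..t. multinom n) dvd c * (\<Prod>n=1..t. multinom (k * n))"
proof -
  have "\<forall>b. \<exists>Q. b > 0 \<longrightarrow> (\<forall>q\<ge>Q. coprime b q \<longrightarrow> (\<forall>T. excess b q T \<ge> 0))"
    using excess_eventually_nonneg by blast
  then obtain Q where Q: "\<And>b q T. b > 0 \<Longrightarrow> q \<ge> Q b \<Longrightarrow> coprime b q \<Longrightarrow> excess b q T \<ge> 0"
    by metis
  \<comment> \<open>The part b varies with p but is at most k, so one threshold serves all
    primes.\<close>
  define B where "B = Max (Q ` {1..k})"
  have B: "excess b q T \<ge> 0" if "b \<in> {1..k}" "q \<ge> B" "coprime b q" for b q T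
    using that Q[of b q T] Max_ge[of "Q ` {1..k}" "Q b"] unfolding B_def by force
  \<comment> \<open>For a fixed p fewer than B positive exponents j have p^j < B, and each loses at
    most |I| B.\<close>
  define c where "c = (\<Prod>p | prime p \<and> p < B. p ^ (card I * B * B))"
  have c: "c > 0" unfolding c_def by (intro prod_pos) (auto simp: prime_gt_0_nat)
  have "(\<Prod>n=1..t. multinom n) dvd c * (\<Prod>n=1..t. multinom (k * n))" for t
  proof (rule multiplicity_le_imp_dvd)
    show "(\<Prod>n=1..t. multinom n) \<noteq> 0" using multinom_pos by (simp add: less_not_refl3)
    fix p :: nat assume p: "prime p"
    obtain b where b: "k = p ^ multiplicity p k * b" "\<not> p dvd b"
      using multiplicity_decompose'[of k p] assms p not_prime_unit by blast
    have "b > 0" using b(1) assms by (cases b) auto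
    moreover have "1 * b \<le> p ^ multiplicity p k * b"
      using p by (intro mult_le_mono1) (simp add: prime_gt_0_nat Suc_le_eq)
    then have "b \<le> k" using b(1) by simp
    ultimately have bk: "b \<in> {1..k}" by auto
    have cop: "coprime b (p ^ j)" for j
      using prime_imp_coprime[OF p b(2)] by (simp add: coprime_commute)
    have nz: "(\<Prod>n=1..t. multinom (a * n)) \<noteq> 0" for a
      using multinom_pos by (simp add: less_not_refl3)
    define J where "J = M * b * t"
    have "multiplicity p (\<Prod>n=1..t. multinom (k * n)) = (\<Sum>n=1..t. multiplicity p (multinom (k * n)))"
      using p nz by (intro prime_elem_multiplicity_prod_distrib) (auto simp: image_iff)
    also have "\<dots> = (\<Sum>n=1..t. multiplicity p (multinom (b * n)))"
      by (subst b(1)) (simp only: mult.assoc multiplicity_multinom_times_prime_power[OF p])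
    also have "\<dots> = multiplicity p (\<Prod>n=1..t. multinom (b * n))"
      using p nz by (intro prime_elem_multiplicity_prod_distrib[symmetric]) (auto simp: image_iff)
    finally have mk: "multiplicity p (\<Prod>n=1..t. multinom (k * n))
        = multiplicity p (\<Prod>n=1..t. multinom (b * n))" .
    have "int (multiplicity p (\<Prod>n=1..t. multinom n)) - int (multiplicity p (\<Prod>n=1..t. multinom (k * n)))
        = (\<Sum>j=1..J. - excess b (p ^ j) (Suc t))"
      using multiplicity_prod_multinom[OF p, of b t J] \<open>b > 0\<close> mk by (simp add: J_def sum_negf)
    also have "\<dots> \<le> int (multiplicity p c)"
    proof (cases "p < B")
      case True
      have "(\<Sum>j=1..J. - excess b (p ^ j) (Suc t)) \<le> (\<Sum>j=1..J. if j < B then int (card I * B) else 0)"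
      proof (intro sum_mono)
        fix j assume j: "j \<in> {1..J}"
        \<comment> \<open>Hence p^j < B implies j < B, which bounds the number of lossy
          exponents.\<close>
        have pj: "p ^ j > j" using p by (intro power_gt_expt) (simp add: prime_gt_Suc_0_nat)
        show "- excess b (p ^ j) (Suc t) \<le> (if j < B then int (card I * B) else 0)"
        proof (cases "p ^ j < B")
          case True
          have "- excess b (p ^ j) (Suc t) \<le> int (card I * p ^ j)"
            using excess_ge[OF cop, of j "Suc t"] p by (simp add: prime_gt_0_nat)
          also have "\<dots> \<le> int (card I * B)"
            using True by (simp only: of_nat_le_iff) (simp add: less_imp_le)
          finally show ?thesis using True pj by simp
        next
          case False
          then have "- excess b (p ^ j) (Suc t) \<le> 0" using B[OF bk _ cop, of j "Suc t"] by simp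
          also have "0 \<le> (if j < B then int (card I * B) else 0)" by simp
          finally show ?thesis .
        qed
      qed
      also have "\<dots> = (\<Sum>j\<in>{1..J} \<inter> {j. j < B}. int (card I * B))"
        by (simp add: sum.If_cases)
      also have "\<dots> \<le> (\<Sum>j<B. int (card I * B))"
        by (intro sum_mono2) auto
      also have "\<dots> = int (card I * B * B)" by simp
      also have "card I * B * B = multiplicity p c"
        unfolding c_def using True p
        by (subst multiplicity_prod_prime_powers) auto
      finally show ?thesis .
    next
      case False
      have "p ^ j \<ge> B" if "j \<in> {1..J}" for j
      proof -
        have "p ^ 1 \<le> p ^ j" using that p by (intro power_increasing) (auto simp: prime_gt_0_nat Suc_le_eq)
        with False show ?thesis by simp
      qed
      then have "(\<Sum>j=1..J. - excess b (p ^ j) (Suc t)) \<le> 0"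
        using B[OF bk _ cop] by (intro sum_nonpos) auto
      then show ?thesis by simp
    qed
    finally have "multiplicity p (\<Prod>n=1..t. multinom n)
        \<le> multiplicity p c + multiplicity p (\<Prod>n=1..t. multinom (k * n))" by linarith
    also have "\<dots> = multiplicity p (c * (\<Prod>n=1..t. multinom (k * n)))"
      using p nz c by (subst prime_elem_multiplicity_mult_distrib) auto
    finally show "multiplicity p (\<Prod>n=1..t. multinom n)
      \<le> multiplicity p (c * (\<Prod>n=1..t. multinom (k * n)))" .
  qed
  with c show ?thesis by blast
qed

end

section \<open>Passage to rational quotients\<close>

theorem theorem1:
  fixes s :: nat and m :: "nat \<Rightarrow> nat" and k :: nat
  assumes "s \<ge> 1"
    and "\<And>i. i \<in> {1..s} \<Longrightarrow> m i > 0"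
    and "(GCD i\<in>{1..s}. m i) = 1"
    and "k \<ge> 1"
  shows "almost_mean_divisible k
    (\<lambda>n. fact ((\<Sum>i=1..s. m i) * n) / (\<Prod>i=1..s. fact (m i * n)))"
proof -
  interpret coprime_parts "{1..s}" m
    using assms by unfold_locales auto
  have a: "fact ((\<Sum>i=1..s. m i) * n) / (\<Prod>i=1..s. fact (m i * n)) = (of_nat (multinom n) :: rat)" for n
  proof -
    have "of_nat (multinom n) * (\<Prod>i=1..s. fact (m i * n)) = (of_nat (fact (M * n)) :: rat)"
      unfolding multinom_mult[symmetric] by simp
    then show ?thesis unfolding M_def by (simp add: field_simps)
  qed
  obtain c where c: "c > 0"
    "\<And>t. (\<Prod>n=1..t. multinom n) dvd c * (\<Prod>n=1..t. multinom (k * n))"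
    using prod_multinom_dvd[of k] assms(4) by auto
  have "\<exists>z::int. (\<Prod>n=1..t. of_nat (multinom (k * n))) / (\<Prod>n=1..t. of_nat (multinom n))
      = (of_int z / of_nat c :: rat)" for t
  proof -
    let ?A = "\<Prod>n=1..t. multinom n" and ?B = "\<Prod>n=1..t. multinom (k * n)"
    obtain d where "c * ?B = ?A * d" using c(2)[of t] by (elim dvdE)
    then have "of_nat c * of_nat ?B = (of_nat ?A * of_nat d :: rat)"
      by (simp only: of_nat_mult[symmetric])
    moreover have "of_nat ?A \<noteq> (0 :: rat)"
      using multinom_pos by (simp add: less_not_refl3)
    ultimately have "of_nat ?B / of_nat ?A = (of_int (int d) / of_nat c :: rat)"
      using c(1) by (simp add: field_simps del: of_nat_prod)
    then show ?thesis unfolding of_nat_prod by blast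
  qed
  with c(1) show ?thesis
    unfolding almost_mean_divisible_def a using multinom_pos by (auto simp: less_not_refl3)
qed

end
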